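(* There is an absolute constant $c>0$ such that the number of proper elements of $S_n$ (the Coxeter group of type $A_{n-1}$), the number of proper elements of $S_n^D$ (the Coxeter group of type $D_n$), and the number of proper elements of $S_n^B$ (the Coxeter group of type $B_n$) are each at least $(cn)^n$, for every $n\ge 2$ (and $n\ge 4$ in the case of $S_n^D$).
   Context: Let $(W,S)$ be a finite Coxeter system with $S=\{s_1,\dots,s_N\}$ of rank $N$ and Coxeter length $\ell$. For $I\subseteq[N]=\{1,\dots,N\}$ let $W_I$ be the parabolic subgroup generated by $\{s_i\mid i\in I\}$, with longest element $w_0(W_I)$. For $w\in W$ let $d(w)=\#\{j\in[N]\mid \ell(s_jw)<\ell(w)\}$ be the number of left descents. Put $\mathsf{maxw}_0(W,x)=\max\{\ell(w_0(W_I))\mid I\subseteq[N],\ |I|=x\}$. An element $w\in W$ is proper if $\ell(w)\le N+\mathsf{maxw}_0(W,d(w))$. $S_n$ is the symmetric group with generators the transpositions $(i,i+1)$, $1\le i<n$ (type $A_{n-1}$, rank $n-1$). $S_n^B$ is the group of signed permutations, i.e. bijections $w$ of $\{-n,\dots,-1,1,\dots,n\}$ with $w(-i)=-w(i)$, with Coxeter generators the signed permutations exchanging $i$ and $i+1$ (and $-i$ and $-i-1$) for $1\le i<n$, together with the one exchanging $1$ and $-1$ (type $B_n$, rank $n$). $S_n^D\subset S_n^B$ is the subgroup of those $w$ with $\#\{i\in\{1,\dots,n\}\mid w(i)<0\}$ even, with Coxeter generators those exchanging $i$ and $i+1$ for $1\le i<n$, together with the one exchanging $1$ with $-2$ and $2$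 with $-1$ (type $D_n$, rank $n$). *)

theory Defs
  imports Complex_Main "HOL-Algebra.Generated_Groups" "HOL-Algebra.Sym_Groups"
begin

text \<open>A Coxeter system of rank \<open>N\<close> is given by a group \<open>G\<close> together with the family
  \<open>s 1, \<dots>, s N\<close> of its Coxeter generators. The notions below only use these data; they are
  applied to the Coxeter systems of types \<open>A\<close>, \<open>B\<close> and \<open>D\<close> further down.\<close>

definition word_prod :: "('a, 'b) monoid_scheme \<Rightarrow> (nat \<Rightarrow> 'a) \<Rightarrow> nat list \<Rightarrow> 'a" where
  "word_prod G s js = foldr (\<lambda>j w. s j \<otimes>\<^bsub>G\<^esub> w) js \<one>\<^bsub>G\<^esub>"

definition cox_length :: "('a, 'b) monoid_scheme \<Rightarrow> (nat \<Rightarrow> 'a) \<Rightarrow> nat \<Rightarrow> 'a \<Rightarrow> nat" where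
  "cox_length G s N w =
     (LEAST k. \<exists>js. length js = k \<and> set js \<subseteq> {1..N} \<and> word_prod G s js = w)"

definition parabolic :: "('a, 'b) monoid_scheme \<Rightarrow> (nat \<Rightarrow> 'a) \<Rightarrow> nat set \<Rightarrow> 'a set" where
  "parabolic G s I = generate G (s ` I)"

text \<open>For \<open>I \<subseteq> {1..N}\<close> the length function of \<open>W\<^sub>I\<close> is the restriction of the one of \<open>W\<close>,
  and in a finite Coxeter group the element of maximal length is unique, so that the choice made
  by \<^const>\<open>arg_max_on\<close> is immaterial.\<close>

definition longest_element ::
    "('a, 'b) monoid_scheme \<Rightarrow> (nat \<Rightarrow> 'a) \<Rightarrow> nat \<Rightarrow> nat set \<Rightarrow> 'a" where
  "longest_element G s N I = arg_max_on (cox_length G s N) (parabolic G s I)"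

definition left_descent_number ::
    "('a, 'b) monoid_scheme \<Rightarrow> (nat \<Rightarrow> 'a) \<Rightarrow> nat \<Rightarrow> 'a \<Rightarrow> nat" where
  "left_descent_number G s N w =
     card {j \<in> {1..N}. cox_length G s N (s j \<otimes>\<^bsub>G\<^esub> w) < cox_length G s N w}"

definition maxw0 :: "('a, 'b) monoid_scheme \<Rightarrow> (nat \<Rightarrow> 'a) \<Rightarrow> nat \<Rightarrow> nat \<Rightarrow> nat" where
  "maxw0 G s N x =
     Max {cox_length G s N (longest_element G s N I) | I. I \<subseteq> {1..N} \<and> card I = x}"

definition proper_element ::
    "('a, 'b) monoid_scheme \<Rightarrow> (nat \<Rightarrow> 'a) \<Rightarrow> nat \<Rightarrow> 'a \<Rightarrow> bool" where
  "proper_element G s N w \<longleftrightarrow>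
     w \<in> carrier G \<and> cox_length G s N w \<le> N + maxw0 G s N (left_descent_number G s N w)"

text \<open>Type \<open>A\<^bsub>n-1\<^esub>\<close>: the group is \<^term>\<open>sym_group n\<close>, with generators indexed by \<open>{1..n-1}\<close>.\<close>

definition genA :: "nat \<Rightarrow> nat \<Rightarrow> nat" where
  "genA i = transpose i (i + 1)"

text \<open>Signed permutations are extended by the identity to all of \<^typ>\<open>int\<close>, like the elements
  of \<^const>\<open>sym_group\<close>. The additional generator of types \<open>B\<^sub>n\<close> and \<open>D\<^sub>n\<close> has index \<open>n\<close>.\<close>

definition signed_sym_group :: "nat \<Rightarrow> (int \<Rightarrow> int) monoid" where
  "signed_sym_group n =
     \<lparr> carrier = {w. w permutes ({- int n..int n} - {0}) \<and> (\<forall>i. w (- i) = - w i)},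
       mult = (\<circ>), one = id \<rparr>"

definition even_signed_sym_group :: "nat \<Rightarrow> (int \<Rightarrow> int) monoid" where
  "even_signed_sym_group n = (signed_sym_group n)
     \<lparr> carrier := {w \<in> carrier (signed_sym_group n). even (card {i \<in> {1..int n}. w i < 0})} \<rparr>"

definition signed_swap :: "int \<Rightarrow> int \<Rightarrow> int \<Rightarrow> int" where
  "signed_swap i j = transpose i j \<circ> transpose (- i) (- j)"

definition genB :: "nat \<Rightarrow> nat \<Rightarrow> int \<Rightarrow> int" where
  "genB n i = (if i < n then signed_swap (int i) (int i + 1) else transpose 1 (- 1))"

definition genD :: "nat \<Rightarrow> nat \<Rightarrow> int \<Rightarrow> int" where
  "genD n i = (if i < n then signed_swap (int i) (int i + 1) else signed_swap 1 (- 2))"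

end

theory Submission
  imports Defs
begin

text \<open>All three groups contain \<open>S\<^sub>n\<close> as the standard parabolic subgroup on the generators
  \<open>1, \<dots>, n - 1\<close>, and on it the Coxeter length is the number of inversions. If \<open>d < n\<close> and \<open>d \<le> x\<close>, then
  \<open>W\<^sub>I\<close> with \<open>I = {1, \<dots>, x}\<close> contains \<open>S\<^bsub>d+1\<^esub>\<close>, so a permutation with at least \<open>d\<close> left descents
  and at most \<open>n - 1 + d (d + 1) / 2\<close> inversions is proper in each of the groups. Take the permutations
  that preserve at most eight consecutive blocks of even size \<open>q \<le> n / 8 + 2\<close> and whose inverses
  are decreasing on each pair \<open>{2 i + 1, 2 i + 2}\<close>: they have at least \<open>\<lfloor>n / 2\<rfloor>\<close> descents and at most
  \<open>(n - 1) (q - 1)\<close> inversions. At least \<open>n! / 8\<^sup>n\<close> permutations preserve the blocks, since these are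
  the stabiliser of a map to an eight-element set; sorting each pair divides this by at most \<open>2\<^sup>n\<close>.\<close>

text \<open>With the group-inverse notation switched off, \<open>inv \<sigma>\<close> is the inverse
  function; the inverse in a group is written \<open>m_inv\<close>.\<close>

unbundle no m_inv_syntax

subsection \<open>Words and inversions\<close>

lemma word_prod_Nil [simp]: "word_prod G s [] = \<one>\<^bsub>G\<^esub>"
  by (simp add: word_prod_def)

lemma word_prod_Cons [simp]: "word_prod G s (j # js) = s j \<otimes>\<^bsub>G\<^esub> word_prod G s js"
  by (simp add: word_prod_def)

text \<open>The filter \<open>Q\<close> lets one definition serve both cases: in \<open>S_n\<close>
  every pair counts, while for signed permutations \<open>Q\<close> discards the antipodal
  pairs.\<close>

definition inversions :: "('a::linorder \<Rightarrow> 'a \<Rightarrow> bool) \<Rightarrow> 'a set \<Rightarrow> ('a \<Rightarrow> 'a) \<Rightarrow> ('a \<times> 'a) set" where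
  "inversions Q X w = {(x, y). x \<in> X \<and> y \<in> X \<and> x < y \<and> Q x y \<and> w y < w x}"

abbreviation inversion_number :: "nat \<Rightarrow> (nat \<Rightarrow> nat) \<Rightarrow> nat" where
  "inversion_number n \<sigma> \<equiv> card (inversions (\<lambda>_ _. True) {1..n} \<sigma>)"

lemma finite_inversions: "finite X \<Longrightarrow> finite (inversions Q X w)"
  by (rule finite_subset[of _ "X \<times> X"]) (auto simp: inversions_def)

text \<open>A pair that becomes inverted only through \<open>s\<close> is mapped by \<open>w\<close>
  to an increasing pair reversed by \<open>s\<close>, hence to an element of \<open>E\<close>. Since
  \<open>w\<close> is injective, there are at most \<open>card E\<close> such pairs.\<close>

lemma card_inversions_comp_le:
  assumes X: "finite X" and w: "w permutes X"
    and Q: "\<And>x y. Q x y \<Longrightarrow> Q (w x) (w y)" and E: "finite E"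
    and s: "\<And>u v. u \<in> X \<Longrightarrow> v \<in> X \<Longrightarrow> u < v \<Longrightarrow> Q u v \<Longrightarrow> s v < s u \<Longrightarrow> (u, v) \<in> E"
  shows "card (inversions Q X (s \<circ> w)) \<le> card (inversions Q X w) + card E"
proof -
  let ?F = "{(x, y). x \<in> X \<and> y \<in> X \<and> (w x, w y) \<in> E}"
  have sub: "inversions Q X (s \<circ> w) \<subseteq> inversions Q X w \<union> ?F"
  proof
    fix p assume p: "p \<in> inversions Q X (s \<circ> w)"
    obtain x y where xy: "p = (x, y)" by (cases p)
    from p xy have *: "x \<in> X" "y \<in> X" "x < y" "Q x y" "s (w y) < s (w x)"
      by (auto simp: inversions_def)
    have "w x \<noteq> w y"
      using * permutes_inj[OF w] by (auto dest: injD)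
    moreover have "(w x, w y) \<in> E" if "w x < w y"
      using s[of "w x" "w y"] * that Q permutes_in_image[OF w] by auto
    ultimately show "p \<in> inversions Q X w \<union> ?F"
      using * xy by (auto simp: inversions_def neq_iff)
  qed
  have inj: "inj_on (map_prod w w) ?F"
    using permutes_inj[OF w] by (auto simp: inj_on_def dest: injD)
  have "card ?F \<le> card E"
    by (rule card_inj_on_le[OF inj _ E]) auto
  moreover have "finite ?F"
    by (rule finite_subset[of _ "X \<times> X"]) (auto simp: X)
  then have "card (inversions Q X (s \<circ> w)) \<le> card (inversions Q X w \<union> ?F)"
    by (intro card_mono sub finite_UnI finite_inversions X)
  moreover have "card (inversions Q X w \<union> ?F) \<le> card (inversions Q X w) + card ?F"
    by (rule card_Un_le)
  ultimately show ?thesis by linarith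
qed

text \<open>Each letter adds at most \<open>e\<close> inversions, so inversions bound the length of
  a word from below. The first two conjuncts strengthen the induction: they are the hypotheses on
  \<open>w\<close> in \<open>card_inversions_comp_le\<close>.\<close>

lemma word_prod_inversions:
  assumes G: "mult G = (\<circ>)" "one G = id"
    and X: "finite X" and gen: "\<And>j. j \<in> {1..N} \<Longrightarrow> s j permutes X"
    and Q: "\<And>j x y. j \<in> {1..N} \<Longrightarrow> Q x y \<Longrightarrow> Q (s j x) (s j y)"
    and E: "\<And>j. j \<in> {1..N} \<Longrightarrow> finite (E j) \<and> card (E j) \<le> e"
    and s: "\<And>j u v. j \<in> {1..N} \<Longrightarrow> u \<in> X \<Longrightarrow> v \<in> X \<Longrightarrow> u < v \<Longrightarrow> Q u v \<Longrightarrow> s j v < s j u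
              \<Longrightarrow> (u, v) \<in> E j"
    and js: "set js \<subseteq> {1..N}"
  shows "word_prod G s js permutes X \<and> (\<forall>x y. Q x y \<longrightarrow> Q (word_prod G s js x) (word_prod G s js y)) \<and>
         card (inversions Q X (word_prod G s js)) \<le> e * length js"
  using js
proof (induction js)
  case Nil
  have "inversions Q X id = {}" by (auto simp: inversions_def)
  then show ?case using permutes_id by (simp add: G id_def)
next
  case (Cons j js)
  let ?w = "word_prod G s js"
  have IH: "?w permutes X" "\<And>x y. Q x y \<Longrightarrow> Q (?w x) (?w y)"
      "card (inversions Q X ?w) \<le> e * length js" and j: "j \<in> {1..N}"
    using Cons by auto
  have "card (inversions Q X (s j \<circ> ?w)) \<le> card (inversions Q X ?w) + card (E j)"
    by (rule card_inversions_comp_le) (use X IH(1,2) E s j in auto)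
  with IH E[OF j] have "card (inversions Q X (s j \<circ> ?w)) \<le> e * length (j # js)"
    by simp
  moreover have "word_prod G s (j # js) = s j \<circ> ?w" by (simp add: G)
  ultimately show ?case
    using permutes_compose[OF IH(1) gen[OF j]] IH(2) Q[OF j] by (metis comp_apply)
qed

subsection \<open>The symmetric group\<close>

lemma genA_permutes: "j \<in> {1..n - 1} \<Longrightarrow> genA j permutes {1..n}"
  unfolding genA_def by (rule permutes_swap_id) auto

lemma genA_reverses:
  assumes "u < v" "genA j v < genA j u"
  shows "u = j \<and> v = j + 1"
  using assms by (auto simp: genA_def transpose_def split: if_splits)

lemma inversion_number_word_le:
  assumes "set js \<subseteq> {1..n - 1}"
  shows "inversion_number n (word_prod (sym_group n) genA js) \<le> length js"
proof -
  have "inversion_number n (word_prod (sym_group n) genA js) \<le> 1 * length js"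
    by (rule word_prod_inversions[where N = "n - 1" and E = "\<lambda>j. {(j, j + 1)}", THEN conjunct2, THEN conjunct2])
      (use assms genA_permutes genA_reverses in \<open>auto simp: sym_group_mult sym_group_one\<close>)
  then show ?thesis by simp
qed

text \<open>These are the left descents of \<open>\<sigma>\<close>: the value \<open>j + 1\<close>
  stands before the value \<open>j\<close>, and composing with \<open>genA j\<close> on the left
  exchanges the two values.\<close>

definition inverse_descents :: "nat \<Rightarrow> (nat \<Rightarrow> nat) \<Rightarrow> nat set" where
  "inverse_descents n \<sigma> = {j \<in> {1..n - 1}. inv \<sigma> (j + 1) < inv \<sigma> j}"

lemma finite_inverse_descents [simp]: "finite (inverse_descents n \<sigma>)"
  by (simp add: inverse_descents_def)

lemma inversion_number_genA_less:
  assumes \<sigma>: "\<sigma> permutes {1..n}" and j: "j \<in> inverse_descents n \<sigma>"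
  shows "inversion_number n (genA j \<circ> \<sigma>) < inversion_number n \<sigma>"
proof (rule psubset_card_mono)
  let ?I = "inversions (\<lambda>_ _. True) {1..n}"
  let ?a = "inv \<sigma> (j + 1)" and ?b = "inv \<sigma> j"
  have j': "j \<in> {1..n}" "j + 1 \<in> {1..n}" "?a < ?b"
    using j by (auto simp: inverse_descents_def)
  have ab: "\<sigma> ?a = j + 1" "\<sigma> ?b = j" "?a \<in> {1..n}" "?b \<in> {1..n}"
    using permutes_inverses[OF \<sigma>] permutes_in_image[OF permutes_inv[OF \<sigma>]] j' by blast+
  \<comment> \<open>The positions of the values \<open>j + 1\<close> and \<open>j\<close> form the
    one inversion that is lost; it remains to see that none is gained.\<close>
  have "(?a, ?b) \<in> ?I \<sigma>" "(?a, ?b) \<notin> ?I (genA j \<circ> \<sigma>)"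
    using ab j' by (auto simp: inversions_def genA_def)
  moreover have "?I (genA j \<circ> \<sigma>) \<subseteq> ?I \<sigma>"
  proof
    fix p assume p: "p \<in> ?I (genA j \<circ> \<sigma>)"
    obtain x y where xy: "p = (x, y)" by (cases p)
    from p xy have *: "x \<in> {1..n}" "y \<in> {1..n}" "x < y" "genA j (\<sigma> y) < genA j (\<sigma> x)"
      by (auto simp: inversions_def)
    have "\<not> \<sigma> x < \<sigma> y"
    proof
      assume "\<sigma> x < \<sigma> y"
      then have "\<sigma> x = j" "\<sigma> y = j + 1" using genA_reverses * by auto
      then have "x = ?b" "y = ?a" using permutes_inverses(2)[OF \<sigma>] by metis+
      with * j' show False by simp
    qed
    moreover have "\<sigma> x \<noteq> \<sigma> y" using * permutes_inj[OF \<sigma>] by (auto dest: injD)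
    ultimately show "p \<in> ?I \<sigma>" using * xy by (auto simp: inversions_def)
  qed
  ultimately show "?I (genA j \<circ> \<sigma>) \<subset> ?I \<sigma>" by blast
qed (simp add: finite_inversions)

text \<open>Without descents the inverse is strictly increasing on \<open>{1..n}\<close>, so it maps
  no point below itself, and such a permutation is the identity.\<close>

lemma inverse_descents_empty:
  assumes \<sigma>: "\<sigma> permutes {1..n}" and "inverse_descents n \<sigma> = {}"
  shows "\<sigma> = id"
proof -
  let ?\<tau> = "inv \<sigma>"
  have \<tau>: "?\<tau> permutes {1..n}" by (rule permutes_inv[OF \<sigma>])
  have step: "?\<tau> j < ?\<tau> (j + 1)" if "j \<in> {1..n - 1}" for j
  proof -
    have "?\<tau> j \<noteq> ?\<tau> (j + 1)" using permutes_inj[OF \<tau>] by (metis injD n_not_Suc_n Suc_eq_plus1)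
    then show ?thesis using assms(2) that by (auto simp: inverse_descents_def)
  qed
  have "j \<le> ?\<tau> j" if "1 \<le> j" "j \<le> n" for j
    using that
  proof (induction j rule: nat_induct_at_least)
    case base
    then show ?case using permutes_in_image[OF \<tau>, of 1] by auto
  next
    case (Suc j)
    then show ?case using step[of j] by fastforce
  qed
  then have "?\<tau> = id" by (intro permutes_natset_ge[OF \<tau>]) auto
  then show ?thesis using permutes_inv_inv[OF \<sigma>] by (metis inv_id)
qed

text \<open>Sorting by adjacent exchanges: stripping a left descent removes at least one inversion,
  and only the identity has no descent.\<close>

lemma ex_word_inversion_number:
  assumes "\<sigma> permutes {1..n}"
  shows "\<exists>js. set js \<subseteq> {1..n - 1} \<and> word_prod (sym_group n) genA js = \<sigma> \<and>
              length js \<le> inversion_number n \<sigma>"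
  using assms
proof (induction "inversion_number n \<sigma>" arbitrary: \<sigma> rule: less_induct)
  case less
  show ?case
  proof (cases "inverse_descents n \<sigma> = {}")
    case True
    then have "\<sigma> = id" using inverse_descents_empty less.prems by blast
    then show ?thesis by (intro exI[of _ "[]"]) (simp add: sym_group_one)
  next
    case False
    then obtain j where j: "j \<in> inverse_descents n \<sigma>" by blast
    then have j': "j \<in> {1..n - 1}" by (simp add: inverse_descents_def)
    have lt: "inversion_number n (genA j \<circ> \<sigma>) < inversion_number n \<sigma>"
      by (rule inversion_number_genA_less[OF less.prems j])
    have "genA j \<circ> \<sigma> permutes {1..n}"
      by (rule permutes_compose[OF less.prems genA_permutes[OF j']])
    from less.hyps[OF lt this] obtain js where js: "set js \<subseteq> {1..n - 1}"
      "word_prod (sym_group n) genA js = genA j \<circ> \<sigma>"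
      "length js \<le> inversion_number n (genA j \<circ> \<sigma>)" by blast
    have "genA j \<circ> (genA j \<circ> \<sigma>) = \<sigma>"
      by (simp add: genA_def fun_eq_iff)
    then show ?thesis using js lt j' by (intro exI[of _ "j # js"]) (auto simp: sym_group_mult)
  qed
qed

section \<open>The longest element of \<open>S_k\<close>\<close>

definition reversal :: "nat \<Rightarrow> nat \<Rightarrow> nat" where
  "reversal k x = (if x \<in> {1..k} then k + 1 - x else x)"

lemma reversal_permutes: "reversal k permutes {1..k}"
proof (rule bij_imp_permutes)
  show "bij_betw (reversal k) {1..k} {1..k}"
    by (rule bij_betw_byWitness[where f' = "reversal k"]) (auto simp: reversal_def)
qed (auto simp: reversal_def)

lemma card_ordered_pairs:
  "2 * card {(x, y). x \<in> {1..k} \<and> y \<in> {1..k} \<and> x < (y::nat)} = k * (k - 1)"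
proof (induction k)
  case (Suc k)
  let ?P = "\<lambda>k. {(x, y). x \<in> {1..k} \<and> y \<in> {1..k} \<and> x < (y::nat)}"
  have eq: "?P (Suc k) = ?P k \<union> {1..k} \<times> {Suc k}" by auto
  have "finite (?P k)" by (rule finite_subset[of _ "{1..k} \<times> {1..k}"]) auto
  then have "card (?P (Suc k)) = card (?P k) + k"
    unfolding eq by (subst card_Un_disjoint) (auto simp: card_cartesian_product)
  then show ?case using Suc by (cases k) auto
qed simp

lemma inversion_number_reversal:
  assumes "k \<le> n"
  shows "k * (k - 1) \<le> 2 * inversion_number n (reversal k)"
proof -
  have "{(x, y). x \<in> {1..k} \<and> y \<in> {1..k} \<and> x < y} \<subseteq> inversions (\<lambda>_ _. True) {1..n} (reversal k)"
    using assms by (auto simp: inversions_def reversal_def)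
  then have "card {(x, y). x \<in> {1..k} \<and> y \<in> {1..k} \<and> x < y} \<le> inversion_number n (reversal k)"
    by (intro card_mono) (auto intro: finite_inversions)
  then show ?thesis using card_ordered_pairs[of k] by linarith
qed

subsection \<open>Counting permutations with few inversions and many descents\<close>

text \<open>The stabiliser of a colouring \<open>c\<close>, whose fibres are the blocks. Points
  outside \<open>{1..n}\<close> are fixed, so quantifying over all \<open>i\<close> imposes nothing
  on them.\<close>

definition block_perms :: "(nat \<Rightarrow> nat) \<Rightarrow> nat \<Rightarrow> (nat \<Rightarrow> nat) set" where
  "block_perms c n = {\<tau>. \<tau> permutes {1..n} \<and> (\<forall>i. c (\<tau> i) = c i)}"

lemma finite_block_perms: "finite (block_perms c n)"
  by (rule finite_subset[OF _ finite_permutations[of "{1..n}"]]) (auto simp: block_perms_def)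

text \<open>Orbit counting: \<open>\<tau> \<mapsto> c \<circ> \<tau>\<close> takes at most
  \<open>m ^ n\<close> values on \<open>{1..n}\<close>, and each nonempty fibre is a coset of the
  stabiliser.\<close>

lemma fact_le_card_block_perms:
  assumes c: "\<And>i. i \<in> {1..n} \<Longrightarrow> c i < m"
  shows "fact n \<le> m ^ n * card (block_perms c n)"
proof -
  let ?S = "{\<tau>. \<tau> permutes {1..n}}" and ?T = "{1..n} \<rightarrow>\<^sub>E {..<m}"
  let ?F = "\<lambda>\<tau>. restrict (c \<circ> \<tau>) {1..n}"
  have img: "?F ` ?S \<subseteq> ?T"
    using c permutes_in_image by fastforce
  have finT: "finite ?T" by (intro finite_PiE) auto
  have fib: "card {\<tau> \<in> ?S. ?F \<tau> = f} \<le> card (block_perms c n)" for f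
  proof (cases "{\<tau> \<in> ?S. ?F \<tau> = f} = {}")
    case False
    then obtain \<rho> where \<rho>: "\<rho> permutes {1..n}" "?F \<rho> = f" by blast
    \<comment> \<open>Dividing by one fixed element \<open>\<rho>\<close> of the fibre carries the
      fibre injectively into the stabiliser.\<close>
    let ?g = "\<lambda>\<tau>. \<tau> \<circ> inv \<rho>"
    have inj: "inj_on ?g {\<tau> \<in> ?S. ?F \<tau> = f}"
    proof (rule inj_onI)
      fix x y assume "?g x = ?g y"
      then have "?g x \<circ> \<rho> = ?g y \<circ> \<rho>" by simp
      then show "x = y" by (simp add: o_assoc[symmetric] permutes_inv_o[OF \<rho>(1)])
    qed
    have "?g ` {\<tau> \<in> ?S. ?F \<tau> = f} \<subseteq> block_perms c n"
    proof safe
      fix \<tau> assume \<tau>: "\<tau> permutes {1..n}" "f = ?F \<tau>"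
      have "c (\<tau> (inv \<rho> i)) = c i" for i
      proof (cases "i \<in> {1..n}")
        case True
        then have *: "inv \<rho> i \<in> {1..n}" using permutes_in_image[OF permutes_inv[OF \<rho>(1)]] by blast
        have "?F \<tau> (inv \<rho> i) = ?F \<rho> (inv \<rho> i)" using \<tau>(2) \<rho>(2) by simp
        with * show ?thesis using permutes_inverses[OF \<rho>(1)] by simp
      next
        case False
        then show ?thesis
          using permutes_not_in[OF \<tau>(1)] permutes_not_in[OF permutes_inv[OF \<rho>(1)]] by metis
      qed
      then show "?g \<tau> \<in> block_perms c n"
        using permutes_compose[OF permutes_inv[OF \<rho>(1)] \<tau>(1)] by (simp add: block_perms_def)
    qed
    then show ?thesis by (rule card_inj_on_le[OF inj _ finite_block_perms])
  next
    case True
    then show ?thesis by (metis card.empty le0)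
  qed
  have "fact n = card ?S" by (simp add: card_permutations)
  also have "?S = (\<Union>f\<in>?T. {\<tau> \<in> ?S. ?F \<tau> = f})" using img by blast
  also have "card \<dots> \<le> (\<Sum>f\<in>?T. card {\<tau> \<in> ?S. ?F \<tau> = f})"
    by (rule card_UN_le[OF finT])
  also have "\<dots> \<le> (\<Sum>f\<in>?T. card (block_perms c n))"
    by (intro sum_mono fib)
  also have "\<dots> = m ^ n * card (block_perms c n)"
    by (simp add: card_PiE)
  finally show ?thesis .
qed

section \<open>Sorting adjacent pairs within the blocks\<close>

definition odd_below :: "nat \<Rightarrow> nat set" where
  "odd_below n = {j. odd j \<and> j < n}"

text \<open>The product of the disjoint transpositions \<open>(j, j + 1)\<close> for
  \<open>j \<in> D\<close>, where \<open>D\<close> consists of odd numbers. At \<open>i = 0\<close>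
  the truncated \<open>i - 1\<close> is \<open>0\<close>, which is not in such a \<open>D\<close>,
  so \<open>0\<close> is fixed.\<close>

definition swap_pairs :: "nat set \<Rightarrow> nat \<Rightarrow> nat" where
  "swap_pairs D i = (if odd i \<and> i \<in> D then i + 1 else if even i \<and> i - 1 \<in> D then i - 1 else i)"

lemma swap_pairs_swap_pairs: "D \<subseteq> odd_below n \<Longrightarrow> swap_pairs D (swap_pairs D i) = i"
  by (auto simp: swap_pairs_def odd_below_def elim!: oddE evenE)

lemma swap_pairs_permutes:
  assumes D: "D \<subseteq> odd_below n"
  shows "swap_pairs D permutes {1..n}"
proof (rule bij_imp_permutes)
  have img: "swap_pairs D ` {1..n} \<subseteq> {1..n}"
    using D by (auto simp: swap_pairs_def odd_below_def elim!: oddE evenE)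
  show "bij_betw (swap_pairs D) {1..n} {1..n}"
    by (rule bij_betw_byWitness[where f' = "swap_pairs D"]) (use swap_pairs_swap_pairs[OF D] img in blast)+
  show "swap_pairs D i = i" if "i \<notin> {1..n}" for i
    using D that by (auto simp: swap_pairs_def odd_below_def elim!: oddE evenE)
qed

definition descending_block_perms :: "(nat \<Rightarrow> nat) \<Rightarrow> nat \<Rightarrow> (nat \<Rightarrow> nat) set" where
  "descending_block_perms c n = {\<tau> \<in> block_perms c n. \<forall>j\<in>odd_below n. \<tau> (j + 1) < \<tau> j}"

text \<open>Exchanging the increasing pairs makes a block permutation descending, and it can be
  recovered from the result and the set \<open>D\<close> of exchanged pairs. The assumption on
  \<open>c\<close> puts both members of a pair in one block, so the exchange stays within the
  stabiliser.\<close>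

lemma card_block_perms_le:
  assumes c: "\<And>j. odd j \<Longrightarrow> c (j + 1) = c j"
  shows "card (block_perms c n) \<le> 2 ^ n * card (descending_block_perms c n)"
proof -
  let ?A = "descending_block_perms c n" and ?P = "Pow (odd_below n)"
  have fin: "finite (odd_below n)" by (simp add: odd_below_def)
  have "card (odd_below n) \<le> card {..<n}" by (rule card_mono) (auto simp: odd_below_def)
  then have cardP: "card ?P \<le> 2 ^ n" by (simp add: card_Pow fin)
  have finA: "finite ?A"
    by (rule finite_subset[OF _ finite_block_perms]) (auto simp: descending_block_perms_def)
  have cs: "c (swap_pairs D i) = c i" if "D \<subseteq> odd_below n" for D i
    using c[of i] c[of "i - 1"] that by (auto simp: swap_pairs_def odd_below_def elim!: evenE)
  have "block_perms c n \<subseteq> (\<lambda>(\<tau>, D). \<tau> \<circ> swap_pairs D) ` (?A \<times> ?P)"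
  proof
    fix \<tau> assume \<tau>: "\<tau> \<in> block_perms c n"
    then have perm: "\<tau> permutes {1..n}" by (simp add: block_perms_def)
    define D where "D = {j \<in> odd_below n. \<tau> j < \<tau> (j + 1)}"
    have D: "D \<subseteq> odd_below n" by (auto simp: D_def)
    have "\<tau> \<circ> swap_pairs D \<in> block_perms c n"
      using \<tau> permutes_compose[OF swap_pairs_permutes[OF D] perm] cs[OF D]
      by (auto simp: block_perms_def)
    moreover have "\<tau> (swap_pairs D (j + 1)) < \<tau> (swap_pairs D j)" if j: "j \<in> odd_below n" for j
    proof -
      have "\<tau> j \<noteq> \<tau> (j + 1)" using permutes_inj[OF perm] by (metis injD n_not_Suc_n Suc_eq_plus1)
      then show ?thesis using j by (auto simp: swap_pairs_def D_def odd_below_def)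
    qed
    ultimately have "\<tau> \<circ> swap_pairs D \<in> ?A" by (simp add: descending_block_perms_def)
    moreover have "\<tau> = (\<tau> \<circ> swap_pairs D) \<circ> swap_pairs D"
      by (simp add: fun_eq_iff swap_pairs_swap_pairs[OF D])
    ultimately show "\<tau> \<in> (\<lambda>(\<tau>, D). \<tau> \<circ> swap_pairs D) ` (?A \<times> ?P)"
      using D by (intro image_eqI[where x = "(\<tau> \<circ> swap_pairs D, D)"]) auto
  qed
  then have "card (block_perms c n) \<le> card (?A \<times> ?P)"
    using finA fin by (intro surj_card_le) auto
  also have "\<dots> = card ?P * card ?A" by (simp add: card_cartesian_product)
  also have "\<dots> \<le> 2 ^ n * card ?A" using cardP by simp
  finally show ?thesis .
qed

text \<open>As \<open>c\<close> is monotone and preserved, both members of an inversion have the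
  same colour. Hence for each of the \<open>n - 1\<close> possible left members \<open>x\<close> the
  right one lies among the next \<open>q - 1\<close> points.\<close>

lemma inversion_number_inv_block_le:
  assumes \<tau>: "\<tau> \<in> block_perms c n" and c: "mono c"
    and q: "\<And>x y. 1 \<le> x \<Longrightarrow> c x = c y \<Longrightarrow> y < x + q"
  shows "inversion_number n (inv \<tau>) \<le> (n - 1) * (q - 1)"
proof -
  have perm: "\<tau> permutes {1..n}" and ct: "\<And>i. c (\<tau> i) = c i"
    using \<tau> by (auto simp: block_perms_def)
  have ci: "c (inv \<tau> i) = c i" for i
    using ct[of "inv \<tau> i"] permutes_inverses[OF perm] by simp
  have "inversions (\<lambda>_ _. True) {1..n} (inv \<tau>) \<subseteq> (SIGMA x:{1..n - 1}. {x<..<x + q})"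
  proof
    fix p assume p: "p \<in> inversions (\<lambda>_ _. True) {1..n} (inv \<tau>)"
    obtain x y where xy: "p = (x, y)" by (cases p)
    from p xy have *: "1 \<le> x" "x < y" "y \<le> n" "inv \<tau> y < inv \<tau> x"
      by (auto simp: inversions_def)
    have "c x \<le> c y" "c y \<le> c x"
      using monoD[OF c, of x y] monoD[OF c, of "inv \<tau> y" "inv \<tau> x"] * ci by auto
    then have "y < x + q" using q * by force
    then show "p \<in> (SIGMA x:{1..n - 1}. {x<..<x + q})" using * xy by auto
  qed
  then have "inversion_number n (inv \<tau>) \<le> card (SIGMA x:{1..n - 1}. {x<..<x + q})"
    by (intro card_mono) auto
  also have "\<dots> = (n - 1) * (q - 1)" by (simp add: card_SigmaI)
  finally show ?thesis .
qed

lemma card_odd_below: "card (odd_below n) = n div 2"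
proof -
  have "odd_below n = (\<lambda>i. 2 * i + 1) ` {..<n div 2}"
    by (auto simp: odd_below_def image_iff elim!: oddE)
  then show ?thesis by (simp add: card_image inj_on_def)
qed

text \<open>A criterion for properness common to the three types: \<open>d (d + 1) / 2\<close> is
  the length of the longest element of \<open>S_{d+1}\<close>, and \<open>n - 1\<close> is at most
  the rank. A lower bound \<open>d\<close> for the number of descents suffices.\<close>

definition balanced_perms :: "nat \<Rightarrow> (nat \<Rightarrow> nat) set" where
  "balanced_perms n = {\<sigma>. \<sigma> permutes {1..n} \<and>
     (\<exists>d \<le> card (inverse_descents n \<sigma>). 2 * inversion_number n \<sigma> \<le> 2 * (n - 1) + d * (d + 1))}"

text \<open>A single term of the exponential series at \<open>n\<close> is at most
  \<open>exp n\<close>, and \<open>exp 1 \<le> 3\<close>.\<close>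

lemma power_self_le_fact: "real n ^ n \<le> 3 ^ n * fact n"
proof -
  have "real n ^ n / fact n \<le> exp (real n)"
    using sum_le_suminf[OF summable_exp[of "real n"], of "{n}"]
    by (simp add: exp_def scaleR_conv_of_real field_simps)
  also have "exp (real n) = exp 1 ^ n" by (simp add: exp_of_nat_mult[symmetric])
  also have "\<dots> \<le> 3 ^ n" by (intro power_mono exp_le) auto
  finally show ?thesis by (simp add: field_simps)
qed

lemma card_balanced_perms:
  assumes n: "n \<ge> 1"
  shows "(1 / 48 * real n) ^ n \<le> real (card (balanced_perms n))"
proof -
  \<comment> \<open>The size \<open>q\<close> is even so that no pair is cut, and
    \<open>8 * q = 16 * (a + 1) > n\<close> leaves at most eight blocks. The shift
    \<open>i - 1\<close> makes the first block start at 1.\<close>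
  define a where "a = n div 16"
  define q where "q = 2 * (a + 1)"
  define c where "c i = (i - 1) div q" for i :: nat
  have q0: "q > 0" by (simp add: q_def)
  have cm: "mono c" by (auto simp: mono_def c_def intro!: div_le_mono)
  have c8: "c i < 8" if "i \<in> {1..n}" for i
  proof -
    have "n < 16 * (a + 1)" unfolding a_def by presburger
    then have "i - 1 < 8 * q" using that by (auto simp: q_def)
    then show ?thesis unfolding c_def by (simp add: less_mult_imp_div_less)
  qed
  have codd: "c (j + 1) = c j" if "odd j" for j
  proof -
    obtain k where "j = 2 * k + 1" using \<open>odd j\<close> by (elim oddE)
    then have "(j + 1 - 1) div 2 = (j - 1) div 2" by simp
    then show ?thesis by (simp only: c_def q_def div_mult2_eq)
  qed
  have cq: "y < x + q" if "1 \<le> x" "c x = c y" for x y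
  proof -
    have "(y - 1) div q * q \<le> x - 1" "y - 1 < (y - 1) div q * q + q"
      using that(2) dividend_less_div_times[OF q0, of "y - 1"] div_times_less_eq_dividend[of "x - 1" q]
      by (simp_all add: c_def)
    then show ?thesis using that(1) by linarith
  qed
  \<comment> \<open>Passing to inverses turns the pairs on which \<open>\<tau>\<close> decreases
    into left descents; the witness is \<open>d = n div 2\<close>.\<close>
  have "inv ` descending_block_perms c n \<subseteq> balanced_perms n"
  proof safe
    fix \<tau> assume \<tau>: "\<tau> \<in> descending_block_perms c n"
    then have b: "\<tau> \<in> block_perms c n" and d: "\<And>j. j \<in> odd_below n \<Longrightarrow> \<tau> (j + 1) < \<tau> j"
      by (auto simp: descending_block_perms_def)
    then have perm: "\<tau> permutes {1..n}" by (simp add: block_perms_def)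
    have "odd_below n \<subseteq> inverse_descents n (inv \<tau>)"
    proof
      fix j assume j: "j \<in> odd_below n"
      then have "j \<ge> 1" "j < n" by (auto simp: odd_below_def elim!: oddE)
      then show "j \<in> inverse_descents n (inv \<tau>)"
        using d[OF j] permutes_inv_inv[OF perm] by (auto simp: inverse_descents_def)
    qed
    then have "n div 2 \<le> card (inverse_descents n (inv \<tau>))"
      unfolding card_odd_below[symmetric] by (intro card_mono) auto
    moreover have "2 * inversion_number n (inv \<tau>) \<le> 2 * (n - 1) + (n div 2) * (n div 2 + 1)"
    proof -
      define e where "e = n div 2"
      \<comment> \<open>These bounds explain the choice of about \<open>n / 8\<close> for
        \<open>q\<close>: twice the excess over \<open>n - 1\<close> is
        \<open>(n - 1) * (4 * a) \<le> e * (8 * a) \<le> e * (e + 1)\<close>.\<close>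
      have e: "n - 1 \<le> 2 * e" "8 * a \<le> e" unfolding e_def a_def by presburger+
      have "inversion_number n (inv \<tau>) \<le> (n - 1) * (q - 1)"
        by (rule inversion_number_inv_block_le[OF b cm cq])
      also have "\<dots> = (n - 1) + (n - 1) * (2 * a)" by (simp add: q_def algebra_simps)
      finally have 1: "2 * inversion_number n (inv \<tau>) \<le> 2 * (n - 1) + (n - 1) * (4 * a)" by simp
      have "(n - 1) * (4 * a) \<le> (2 * e) * (4 * a)" using e by (intro mult_right_mono) auto
      also have "\<dots> = e * (8 * a)" by simp
      also have "\<dots> \<le> e * (e + 1)" using e by (intro mult_left_mono) auto
      finally show ?thesis using 1 unfolding e_def by linarith
    qed
    ultimately show "inv \<tau> \<in> balanced_perms n"
      using permutes_inv[OF perm] by (auto simp: balanced_perms_def)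
  qed
  moreover have "inj_on inv (descending_block_perms c n)"
    by (rule inj_on_inverseI[where g = inv])
      (auto simp: descending_block_perms_def block_perms_def intro: permutes_inv_inv)
  moreover have "finite (balanced_perms n)"
    by (rule finite_subset[OF _ finite_permutations[of "{1..n}"]]) (auto simp: balanced_perms_def)
  ultimately have "card (descending_block_perms c n) \<le> card (balanced_perms n)"
    by (intro card_inj_on_le)
  moreover have "fact n \<le> 8 ^ n * (2 ^ n * card (descending_block_perms c n))"
    using fact_le_card_block_perms[of n c 8, OF c8] card_block_perms_le[of c n, OF codd]
    by (meson le_trans mult_le_mono2)
  ultimately have "fact n \<le> 8 ^ n * (2 ^ n * card (balanced_perms n))"
    by (meson le_trans mult_le_mono2)
  then have "real (fact n) \<le> real (8 ^ n * (2 ^ n * card (balanced_perms n)))"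
    by (simp only: of_nat_le_iff)
  then have "real n ^ n \<le> 3 ^ n * (8 ^ n * (2 ^ n * real (card (balanced_perms n))))"
    using power_self_le_fact[of n] by (simp add: order_trans[OF _ mult_left_mono])
  \<comment> \<open>The constant 48 collects 3 from the factorial, 8 from the colours and 2 from
    sorting the pairs.\<close>
  also have "\<dots> = (3 * 8 * 2) ^ n * real (card (balanced_perms n))"
    by (simp only: power_mult_distrib mult.assoc)
  finally show ?thesis by (simp add: power_divide field_simps)
qed

subsection \<open>Groups containing the symmetric group as a standard parabolic subgroup\<close>

lemma cox_length_le:
  assumes "set js \<subseteq> {1..N}" "word_prod G s js = w"
  shows "cox_length G s N w \<le> length js"
  unfolding cox_length_def by (rule Least_le) (use assms in auto)

text \<open>An interface that lets one argument serve types A, B and D. The essential assumption is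
  \<open>emb_word_ge\<close>: even words in all \<open>N\<close> generators cannot express
  \<open>emb \<sigma>\<close> in fewer letters than \<open>\<sigma>\<close> has inversions.\<close>

locale symmetric_parabolic =
  fixes G :: "('a \<Rightarrow> 'a) monoid" and s :: "nat \<Rightarrow> 'a \<Rightarrow> 'a" and N n :: nat
    and X :: "'a set" and emb :: "(nat \<Rightarrow> nat) \<Rightarrow> 'a \<Rightarrow> 'a"
  assumes mult_eq: "mult G = (\<circ>)" and one_eq: "one G = id"
    and finite_X: "finite X" and carrier_permutes: "w \<in> carrier G \<Longrightarrow> w permutes X"
    and gen_carrier: "j \<in> {1..N} \<Longrightarrow> s j \<in> carrier G"
    and gen_gen: "j \<in> {1..N} \<Longrightarrow> s j \<circ> s j = id"
    and n_ge_1: "1 \<le> n" and n_le: "n - 1 \<le> N"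
    and emb_id: "emb id = id"
    and emb_genA: "j \<in> {1..n - 1} \<Longrightarrow> \<sigma> permutes {1..n} \<Longrightarrow> emb (genA j \<circ> \<sigma>) = s j \<circ> emb \<sigma>"
    and emb_carrier: "\<sigma> permutes {1..n} \<Longrightarrow> emb \<sigma> \<in> carrier G"
    and inj_emb: "inj_on emb {\<sigma>. \<sigma> permutes {1..n}}"
    and emb_word_ge: "set js \<subseteq> {1..N} \<Longrightarrow> \<sigma> permutes {1..n} \<Longrightarrow> word_prod G s js = emb \<sigma>
            \<Longrightarrow> inversion_number n \<sigma> \<le> length js"
begin

lemma emb_word_prod:
  assumes "set js \<subseteq> {1..n - 1}"
  shows "word_prod (sym_group n) genA js permutes {1..n} \<and>
         emb (word_prod (sym_group n) genA js) = word_prod G s js"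
  using assms
proof (induction js)
  case Nil
  show ?case using permutes_id emb_id by (simp add: sym_group_one one_eq id_def)
next
  case (Cons j js)
  then have j: "j \<in> {1..n - 1}" and
    IH: "word_prod (sym_group n) genA js permutes {1..n}"
      "emb (word_prod (sym_group n) genA js) = word_prod G s js"
    by auto
  show ?case
    using emb_genA[OF j IH(1)] permutes_compose[OF IH(1) genA_permutes[OF j]] IH(2)
    by (simp add: sym_group_mult mult_eq comp_def)
qed

lemma cox_length_emb:
  assumes \<sigma>: "\<sigma> permutes {1..n}"
  shows "cox_length G s N (emb \<sigma>) = inversion_number n \<sigma>"
proof (rule antisym)
  obtain js where js: "set js \<subseteq> {1..n - 1}" "word_prod (sym_group n) genA js = \<sigma>"
      "length js \<le> inversion_number n \<sigma>"
    using ex_word_inversion_number[OF \<sigma>] by blast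
  then have w: "set js \<subseteq> {1..N}" "word_prod G s js = emb \<sigma>"
    using n_le emb_word_prod[OF js(1)] by auto
  then show "cox_length G s N (emb \<sigma>) \<le> inversion_number n \<sigma>"
    using cox_length_le[OF w] js(3) by linarith
  have "\<exists>js. length js = cox_length G s N (emb \<sigma>) \<and> set js \<subseteq> {1..N} \<and> word_prod G s js = emb \<sigma>"
    unfolding cox_length_def by (rule LeastI_ex) (use w in auto)
  then show "inversion_number n \<sigma> \<le> cox_length G s N (emb \<sigma>)"
    using emb_word_ge[OF _ \<sigma>] by metis
qed

text \<open>Only an inequality, since generators outside \<open>{1..n - 1}\<close> may contribute
  further descents.\<close>

lemma inverse_descents_le:
  assumes \<sigma>: "\<sigma> permutes {1..n}"
  shows "card (inverse_descents n \<sigma>) \<le> left_descent_number G s N (emb \<sigma>)"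
  unfolding left_descent_number_def
proof (rule card_mono)
  show "inverse_descents n \<sigma> \<subseteq>
    {j \<in> {1..N}. cox_length G s N (s j \<otimes>\<^bsub>G\<^esub> emb \<sigma>) < cox_length G s N (emb \<sigma>)}"
  proof
    fix j assume j: "j \<in> inverse_descents n \<sigma>"
    then have j': "j \<in> {1..n - 1}" by (simp add: inverse_descents_def)
    have p: "genA j \<circ> \<sigma> permutes {1..n}"
      by (rule permutes_compose[OF \<sigma> genA_permutes[OF j']])
    have "s j \<otimes>\<^bsub>G\<^esub> emb \<sigma> = emb (genA j \<circ> \<sigma>)"
      using emb_genA[OF j' \<sigma>] by (simp add: mult_eq)
    then show "j \<in> {j \<in> {1..N}. cox_length G s N (s j \<otimes>\<^bsub>G\<^esub> emb \<sigma>) < cox_length G s N (emb \<sigma>)}"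
      using cox_length_emb[OF \<sigma>] cox_length_emb[OF p] inversion_number_genA_less[OF \<sigma> j] j' n_le
      by auto
  qed
qed auto

text \<open>Finiteness bounds the lengths in the subgroup, which ensures that
  \<open>arg_max_on\<close> in \<open>longest_element\<close> attains a maximum.\<close>

lemma finite_parabolic:
  assumes "I \<subseteq> {1..N}"
  shows "finite (parabolic G s I)"
proof (rule finite_subset[OF _ finite_permutations[OF finite_X]])
  \<comment> \<open>The locale does not assume that \<open>G\<close> is a group, so the inverse of
    an involution is computed from the definition of \<open>m_inv\<close>.\<close>
  have inv: "m_inv G (s j) = s j" if "j \<in> I" for j
    unfolding m_inv_def
  proof (rule the_equality)
    have j: "j \<in> {1..N}" using that assms by auto
    show "s j \<in> carrier G \<and> s j \<otimes>\<^bsub>G\<^esub> s j = \<one>\<^bsub>G\<^esub> \<and> s j \<otimes>\<^bsub>G\<^esub> s j = \<one>\<^bsub>G\<^esub>"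
      using gen_carrier[OF j] gen_gen[OF j] by (simp add: mult_eq one_eq)
    fix y assume "y \<in> carrier G \<and> s j \<otimes>\<^bsub>G\<^esub> y = \<one>\<^bsub>G\<^esub> \<and> y \<otimes>\<^bsub>G\<^esub> s j = \<one>\<^bsub>G\<^esub>"
    then have "s j \<circ> (s j \<circ> y) = s j" by (simp add: mult_eq one_eq)
    then show "y = s j" using gen_gen[OF j] by (simp add: o_assoc)
  qed
  have "w permutes X" if "w \<in> parabolic G s I" for w
    using that unfolding parabolic_def
  proof (induction rule: generate.induct)
    case one
    show ?case using permutes_id by (simp add: one_eq id_def)
  next
    case (incl h)
    then show ?case using gen_carrier carrier_permutes assms by auto
  next
    case (inv h)
    then show ?case using gen_carrier carrier_permutes assms \<open>\<And>j. j \<in> I \<Longrightarrow> m_inv G (s j) = s j\<close> by auto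
  next
    case (eng h1 h2)
    then show ?case using permutes_compose[of h2 X h1] by (simp add: mult_eq comp_def)
  qed
  then show "parabolic G s I \<subseteq> {w. w permutes X}" by blast
qed

lemma word_prod_in_parabolic: "set js \<subseteq> I \<Longrightarrow> word_prod G s js \<in> parabolic G s I"
  unfolding parabolic_def
  by (induction js) (auto intro: generate.one generate.eng generate.incl)

section \<open>Lower bounds for \<open>maxw0\<close>\<close>

lemma cox_length_le_longest_element:
  assumes "I \<subseteq> {1..N}" "w \<in> parabolic G s I"
  shows "cox_length G s N w \<le> cox_length G s N (longest_element G s N I)"
  unfolding longest_element_def arg_max_on_def
proof (rule arg_max_nat_le[where f = "cox_length G s N" and P = "\<lambda>x. x \<in> parabolic G s I"])
  let ?L = "cox_length G s N ` parabolic G s I"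
  show "w \<in> parabolic G s I" by fact
  show "\<forall>y. y \<in> parabolic G s I \<longrightarrow> cox_length G s N y < Suc (Max ?L)"
    using finite_parabolic[OF assms(1)] by (auto simp: less_Suc_eq_le)
qed

text \<open>The subset \<open>{1..x}\<close> contains \<open>{1..d}\<close>, so its parabolic
  subgroup contains the image of the reversal of \<open>d + 1\<close> letters.\<close>

lemma maxw0_ge:
  assumes d: "d \<le> x" "d < n" "x \<le> N"
  shows "(d + 1) * d \<le> 2 * maxw0 G s N x"
proof -
  let ?r = "reversal (d + 1)"
  have rn: "?r permutes {1..n}"
    by (rule permutes_subset[OF reversal_permutes]) (use d in auto)
  obtain js where js: "set js \<subseteq> {1..d}" "word_prod (sym_group (d + 1)) genA js = ?r"
    using ex_word_inversion_number[OF reversal_permutes[of "d + 1"]] by auto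
  have "set js \<subseteq> {1..n - 1}" by (rule order_trans[OF js(1)]) (use d in auto)
  \<comment> \<open>The groups \<open>sym_group (d + 1)\<close> and \<open>sym_group n\<close> share
    multiplication and unit, so the same word serves in both.\<close>
  moreover have "word_prod (sym_group n) genA js = ?r"
    using js(2) by (simp add: word_prod_def sym_group_mult sym_group_one)
  ultimately have "word_prod G s js = emb ?r" using emb_word_prod by metis
  moreover have "set js \<subseteq> {1..x}" by (rule order_trans[OF js(1)]) (use d in auto)
  ultimately have par: "emb ?r \<in> parabolic G s {1..x}"
    using word_prod_in_parabolic by metis
  have "(d + 1) * d \<le> 2 * inversion_number n ?r"
    using inversion_number_reversal[of "d + 1" n] d by simp
  also have "inversion_number n ?r = cox_length G s N (emb ?r)"
    by (simp only: cox_length_emb[OF rn])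
  also have "\<dots> \<le> cox_length G s N (longest_element G s N {1..x})"
    by (rule cox_length_le_longest_element[OF _ par]) (use d in auto)
  also have "\<dots> \<le> maxw0 G s N x"
    unfolding maxw0_def
  proof (rule Max_ge)
    show "finite {cox_length G s N (longest_element G s N I) |I. I \<subseteq> {1..N} \<and> card I = x}"
      by (rule finite_subset[of _ "(\<lambda>I. cox_length G s N (longest_element G s N I)) ` Pow {1..N}"]) auto
    show "cox_length G s N (longest_element G s N {1..x})
        \<in> {cox_length G s N (longest_element G s N I) |I. I \<subseteq> {1..N} \<and> card I = x}"
      using d by force
  qed
  finally show ?thesis by simp
qed

lemma proper_element_emb:
  assumes "\<sigma> \<in> balanced_perms n"
  shows "proper_element G s N (emb \<sigma>)"
proof -
  let ?x = "left_descent_number G s N (emb \<sigma>)"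
  obtain d where \<sigma>: "\<sigma> permutes {1..n}" and d: "d \<le> card (inverse_descents n \<sigma>)"
      "2 * inversion_number n \<sigma> \<le> 2 * (n - 1) + d * (d + 1)"
    using assms by (auto simp: balanced_perms_def)
  have "card (inverse_descents n \<sigma>) \<le> card {1..n - 1}"
    by (rule card_mono) (auto simp: inverse_descents_def)
  then have dn: "d < n" using d(1) n_ge_1 by simp
  have dx: "d \<le> ?x" using d(1) inverse_descents_le[OF \<sigma>] by simp
  have "?x \<le> card {1..N}"
    unfolding left_descent_number_def by (rule card_mono) auto
  then have "(d + 1) * d \<le> 2 * maxw0 G s N ?x"
    using maxw0_ge[OF dx dn] by simp
  then have "inversion_number n \<sigma> \<le> N + maxw0 G s N ?x"
    using d(2) n_le by (simp add: mult.commute)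
  then show ?thesis
    using emb_carrier[OF \<sigma>] cox_length_emb[OF \<sigma>] by (simp add: proper_element_def)
qed

lemma card_proper_elements_ge:
  "(1 / 48 * real n) ^ n \<le> real (card {w. proper_element G s N w})"
proof -
  have "finite {w. proper_element G s N w}"
    by (rule finite_subset[OF _ finite_permutations[OF finite_X]])
      (auto simp: proper_element_def dest: carrier_permutes)
  moreover have "inj_on emb (balanced_perms n)"
    by (rule inj_on_subset[OF inj_emb]) (auto simp: balanced_perms_def)
  ultimately have "card (balanced_perms n) \<le> card {w. proper_element G s N w}"
    using proper_element_emb by (intro card_inj_on_le[where f = emb]) auto
  then show ?thesis using card_balanced_perms[OF n_ge_1] by linarith
qed

end

lemma symmetric_parabolic_type_A:
  assumes "n \<ge> 1"
  shows "symmetric_parabolic (sym_group n) genA (n - 1) n {1..n} id"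
proof
  show "inversion_number n \<sigma> \<le> length js"
    if "set js \<subseteq> {1..n - 1}" "word_prod (sym_group n) genA js = id \<sigma>" for js \<sigma>
    using inversion_number_word_le[OF that(1)] that(2) by simp
  show "genA j \<circ> genA j = id" for j
    by (simp add: genA_def fun_eq_iff)
qed (use assms genA_permutes in \<open>auto simp: sym_group_mult sym_group_one sym_group_carrier\<close>)

subsection \<open>Signed permutations\<close>

definition signed_support :: "nat \<Rightarrow> int set" where
  "signed_support n = {- int n..int n} - {0}"

text \<open>The odd extension of \<open>\<sigma>\<close>; the factor \<open>sgn x\<close> makes it
  fix \<open>0\<close>.\<close>

definition signed_ext :: "(nat \<Rightarrow> nat) \<Rightarrow> int \<Rightarrow> int" where
  "signed_ext \<sigma> x = sgn x * int (\<sigma> (nat \<bar>x\<bar>))"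

lemma signed_ext_comp:
  assumes "\<sigma> permutes {1..n}"
  shows "signed_ext (\<rho> \<circ> \<sigma>) = signed_ext \<rho> \<circ> signed_ext \<sigma>"
proof
  fix x :: int
  \<comment> \<open>Positivity is needed so that the inner application keeps the sign of
    \<open>x\<close> for the outer one.\<close>
  have "\<sigma> (nat \<bar>x\<bar>) > 0" if "x \<noteq> 0"
  proof (cases "nat \<bar>x\<bar> \<in> {1..n}")
    case True
    then show ?thesis using permutes_in_image[OF assms, of "nat \<bar>x\<bar>"] by simp
  next
    case False
    then show ?thesis using permutes_not_in[OF assms] that by simp
  qed
  then show "signed_ext (\<rho> \<circ> \<sigma>) x = (signed_ext \<rho> \<circ> signed_ext \<sigma>) x"
    by (cases x "0 :: int" rule: linorder_cases) (simp_all add: signed_ext_def)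
qed

lemma signed_ext_id: "signed_ext id = id"
  by (auto simp: signed_ext_def fun_eq_iff sgn_if)

lemma signed_ext_minus: "signed_ext \<sigma> (- x) = - signed_ext \<sigma> x"
  by (simp add: signed_ext_def sgn_minus)

lemma signed_ext_permutes:
  assumes \<sigma>: "\<sigma> permutes {1..n}"
  shows "signed_ext \<sigma> permutes signed_support n"
proof -
  have "signed_ext \<sigma> \<circ> signed_ext (inv \<sigma>) = id" "signed_ext (inv \<sigma>) \<circ> signed_ext \<sigma> = id"
    using signed_ext_comp[OF \<sigma>] signed_ext_comp[OF permutes_inv[OF \<sigma>]] permutes_inv_o[OF \<sigma>]
      signed_ext_id by metis+
  then have "bij (signed_ext \<sigma>)" by (metis o_bij)
  moreover have "signed_ext \<sigma> x = x" if "x \<notin> signed_support n" for x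
  proof -
    have "nat \<bar>x\<bar> \<notin> {1..n}" using that by (auto simp: signed_support_def)
    then have "signed_ext \<sigma> x = sgn x * \<bar>x\<bar>"
      unfolding signed_ext_def using permutes_not_in[OF \<sigma>] by simp
    then show ?thesis by (simp only: mult_sgn_abs)
  qed
  ultimately show ?thesis by (auto simp: permutes_def bij_iff)
qed

lemma inj_on_signed_ext: "inj_on signed_ext {\<sigma>. \<sigma> permutes {1..n}}"
proof (rule inj_onI, rule ext)
  fix \<sigma> \<rho> x assume *: "\<sigma> \<in> {\<sigma>. \<sigma> permutes {1..n}}" "\<rho> \<in> {\<sigma>. \<sigma> permutes {1..n}}"
    "signed_ext \<sigma> = signed_ext \<rho>"
  show "\<sigma> x = \<rho> x"
  proof (cases "x = 0")
    case True
    then show ?thesis using *(1,2) permutes_not_in[of \<sigma> "{1..n}" 0] permutes_not_in[of \<rho> "{1..n}" 0] by auto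
  next
    case False
    then show ?thesis using fun_cong[OF *(3), of "int x"] by (simp add: signed_ext_def)
  qed
qed

lemma signed_ext_int: "x > 0 \<Longrightarrow> signed_ext \<sigma> (int x) = int (\<sigma> x)"
  by (simp add: signed_ext_def)

lemma signed_swap_apply:
  assumes "0 < \<bar>i\<bar>" "\<bar>i\<bar> < \<bar>j\<bar>"
  shows "signed_swap i j x =
    (if x = i then j else if x = j then i else if x = - i then - j else if x = - j then - i else x)"
proof -
  \<comment> \<open>The four points moved are distinct, so the two transpositions are disjoint.
    Bounding absolute values also covers \<open>signed_swap 1 (- 2)\<close>.\<close>
  have "i \<noteq> j" "i \<noteq> - j" "i \<noteq> - i" "j \<noteq> - j" "- i \<noteq> j" using assms by linarith+
  then show ?thesis by (simp add: signed_swap_def transpose_def)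
qed

lemma signed_swap_minus:
  assumes "0 < \<bar>i\<bar>" "\<bar>i\<bar> < \<bar>j\<bar>"
  shows "signed_swap i j (- x) = - signed_swap i j x"
  using assms unfolding signed_swap_apply[OF assms] by (smt (verit))

lemma signed_swap_signed_swap:
  assumes "0 < \<bar>i\<bar>" "\<bar>i\<bar> < \<bar>j\<bar>"
  shows "signed_swap i j \<circ> signed_swap i j = id"
  using assms unfolding fun_eq_iff comp_def signed_swap_apply[OF assms] id_apply by (smt (verit))

lemma signed_swap_permutes:
  "i \<in> signed_support n \<Longrightarrow> j \<in> signed_support n \<Longrightarrow> signed_swap i j permutes signed_support n"
  unfolding signed_swap_def
  by (intro permutes_compose permutes_swap_id) (auto simp: signed_support_def)

lemma signed_ext_genA:
  assumes "j \<ge> 1"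
  shows "signed_ext (genA j) = signed_swap (int j) (int j + 1)"
proof
  have j: "0 < \<bar>int j\<bar>" "\<bar>int j\<bar> < \<bar>int j + 1\<bar>" using assms by auto
  have *: "signed_ext (genA j) (int m) = signed_swap (int j) (int j + 1) (int m)" for m
    using assms by (cases "m = 0")
      (auto simp: signed_ext_int signed_swap_apply[OF j] genA_def transpose_def signed_ext_def)
  fix x :: int
  show "signed_ext (genA j) x = signed_swap (int j) (int j + 1) x"
  proof (cases "x \<ge> 0")
    case True
    then show ?thesis using *[of "nat x"] by simp
  next
    case False
    then show ?thesis using *[of "nat (- x)"] by (simp add: signed_ext_minus signed_swap_minus[OF j])
  qed
qed

lemma signed_swap_succ_reverses:
  assumes "signed_swap i (i + 1) v < signed_swap i (i + 1) u" "u < v" "i \<ge> 1" "u \<noteq> 0" "v \<noteq> 0"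
  shows "(u, v) \<in> {(i, i + 1), (- i - 1, - i)}"
proof -
  have i: "0 < \<bar>i\<bar>" "\<bar>i\<bar> < \<bar>i + 1\<bar>" using assms(3) by auto
  have "u = i \<and> v = i + 1 \<or> u = - i - 1 \<and> v = - i"
    using assms unfolding signed_swap_apply[OF i] by (smt (verit))
  then show ?thesis by auto
qed

text \<open>Antipodal pairs \<open>(- x, x)\<close> are left out because they are not roots in type \<open>D\<close>; every other
  inversion comes with its mirror image, so each generator changes the count by at most 2, and the
  same lower bound on the length works in types \<open>B\<close> and \<open>D\<close>.\<close>

lemma inversion_number_signed_ext:
  assumes \<sigma>: "\<sigma> permutes {1..n}"
  shows "2 * inversion_number n \<sigma> \<le> card (inversions (\<lambda>x y. y \<noteq> - x) (signed_support n) (signed_ext \<sigma>))"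
proof -
  let ?I = "inversions (\<lambda>_ _. True) {1..n} \<sigma>"
    and ?J = "inversions (\<lambda>x y. y \<noteq> - x) (signed_support n) (signed_ext \<sigma>)"
  \<comment> \<open>Each inversion of \<open>\<sigma>\<close> appears once among positive points and
    once, mirrored, among negative ones.\<close>
  let ?f = "\<lambda>(x, y). (int x, int y)" and ?g = "\<lambda>(x, y). (- int y, - int x)"
  have fin: "finite ?I" by (simp add: finite_inversions)
  have sub: "?f ` ?I \<union> ?g ` ?I \<subseteq> ?J"
    by (auto simp: inversions_def signed_support_def signed_ext_minus signed_ext_int)
  have "card (?f ` ?I) = card ?I" "card (?g ` ?I) = card ?I"
    by (rule card_image, auto simp: inj_on_def)+
  moreover have "?f ` ?I \<inter> ?g ` ?I = {}" by (auto simp: inversions_def)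
  ultimately have "2 * card ?I = card (?f ` ?I \<union> ?g ` ?I)"
    using fin by (subst card_Un_disjoint) auto
  also have "\<dots> \<le> card ?J"
    by (intro card_mono sub finite_inversions) (simp add: signed_support_def)
  finally show ?thesis .
qed

text \<open>The part common to types B and D. What remains is the last generator, which may reverse
  at most two non-antipodal pairs, as many as each of the others.\<close>

lemma symmetric_parabolic_signed:
  fixes G :: "(int \<Rightarrow> int) monoid"
  assumes G: "mult G = (\<circ>)" "one G = id" and n: "n \<ge> 1"
    and carrier: "\<And>w. w \<in> carrier G \<Longrightarrow> w permutes signed_support n"
    and ext: "\<And>\<sigma>. \<sigma> permutes {1..n} \<Longrightarrow> signed_ext \<sigma> \<in> carrier G"
    and s: "\<And>j. j \<in> {1..n - 1} \<Longrightarrow> s j = signed_swap (int j) (int j + 1)"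
    and sn: "s n \<in> carrier G" "s n \<circ> s n = id" "\<And>x. s n (- x) = - s n x"
    and E: "finite E" "card E \<le> 2"
      "\<And>u v. u \<noteq> 0 \<Longrightarrow> v \<noteq> 0 \<Longrightarrow> u < v \<Longrightarrow> v \<noteq> - u \<Longrightarrow> s n v < s n u \<Longrightarrow> (u, v) \<in> E"
  shows "symmetric_parabolic G s n n (signed_support n) signed_ext"
proof
  have cases_j: "j = n \<or> j \<in> {1..n - 1} \<and> s j = signed_swap (int j) (int j + 1)"
    if "j \<in> {1..n}" for j
    using that s[of j] by auto
  show gen: "s j \<in> carrier G" if "j \<in> {1..n}" for j
    using cases_j[OF that] sn(1) ext[OF genA_permutes[of j n]] signed_ext_genA[of j] by auto
  show "s j \<circ> s j = id" if "j \<in> {1..n}" for j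
    using cases_j[OF that] sn(2) signed_swap_signed_swap[of "int j" "int j + 1"] by auto
  show "signed_ext (genA j \<circ> \<sigma>) = s j \<circ> signed_ext \<sigma>"
    if "j \<in> {1..n - 1}" "\<sigma> permutes {1..n}" for j \<sigma>
    using that s signed_ext_comp signed_ext_genA by simp
  show "inversion_number n \<sigma> \<le> length js"
    if "set js \<subseteq> {1..n}" "\<sigma> permutes {1..n}" "word_prod G s js = signed_ext \<sigma>" for js \<sigma>
  proof -
    have odd: "s j (- x) = - s j x" if "j \<in> {1..n}" for j x
      using cases_j[OF that] sn(3) signed_swap_minus[of "int j" "int j + 1" x] by auto
    define F where "F j = (if j = n then E else {(int j, int j + 1), (- int j - 1, - int j)})" for j
    have "card (inversions (\<lambda>x y. y \<noteq> - x) (signed_support n) (word_prod G s js)) \<le> 2 * length js"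
    proof (rule word_prod_inversions[where N = n and E = F, THEN conjunct2, THEN conjunct2])
      show "s j y \<noteq> - s j x" if "j \<in> {1..n}" "y \<noteq> - x" for j x y
        using odd[OF that(1), of x] permutes_inj[OF carrier[OF gen[OF that(1)]]] that(2)
        by (metis injD)
      show "finite (F j) \<and> card (F j) \<le> 2" if "j \<in> {1..n}" for j
        using E by (auto simp: F_def card_insert_if)
      show "(u, v) \<in> F j" if "j \<in> {1..n}" "u \<in> signed_support n" "v \<in> signed_support n"
          "u < v" "v \<noteq> - u" "s j v < s j u" for j u v
        using cases_j[OF that(1)]
      proof
        assume "j = n"
        then show ?thesis using E(3)[of u v] that by (simp add: F_def signed_support_def)
      next
        assume "j \<in> {1..n - 1} \<and> s j = signed_swap (int j) (int j + 1)"
        then show ?thesis using signed_swap_succ_reverses[of "int j" v u] that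
          by (auto simp: F_def signed_support_def)
      qed
    qed (use G that carrier gen in \<open>auto simp: signed_support_def\<close>)
    then show ?thesis using inversion_number_signed_ext[OF that(2)] that(3) by simp
  qed
qed (use G n carrier ext signed_ext_id inj_on_signed_ext in \<open>auto simp: signed_support_def\<close>)

section \<open>The Coxeter systems of types B and D\<close>

lemma signed_sym_group_carrier:
  "w \<in> carrier (signed_sym_group n) \<longleftrightarrow> w permutes signed_support n \<and> (\<forall>i. w (- i) = - w i)"
  by (simp add: signed_sym_group_def signed_support_def)

lemma signed_sym_group_mult: "mult (signed_sym_group n) = (\<circ>)"
  and signed_sym_group_one: "one (signed_sym_group n) = id"
  by (simp_all add: signed_sym_group_def)

lemma even_signed_sym_group_mult: "mult (even_signed_sym_group n) = (\<circ>)"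
  and even_signed_sym_group_one: "one (even_signed_sym_group n) = id"
  by (simp_all add: even_signed_sym_group_def signed_sym_group_def)

lemma even_signed_sym_group_carrier:
  "w \<in> carrier (even_signed_sym_group n) \<longleftrightarrow>
     w \<in> carrier (signed_sym_group n) \<and> even (card {i \<in> {1..int n}. w i < 0})"
  by (simp add: even_signed_sym_group_def)

lemma symmetric_parabolic_type_B:
  assumes "n \<ge> 1"
  shows "symmetric_parabolic (signed_sym_group n) (genB n) n n (signed_support n) signed_ext"
\<comment> \<open>Among nonzero points, exchanging \<open>1\<close> and \<open>- 1\<close> reverses
  only the antipodal pair \<open>(- 1, 1)\<close>.\<close>
proof (rule symmetric_parabolic_signed[where E = "{}"])
  show "genB n n \<in> carrier (signed_sym_group n)"
    using assms permutes_swap_id[of 1 "signed_support n" "- 1"]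
    by (auto simp: signed_sym_group_carrier genB_def signed_support_def transpose_def)
qed (use assms signed_ext_permutes in \<open>auto simp: signed_sym_group_carrier signed_ext_minus
      signed_sym_group_mult signed_sym_group_one genB_def transpose_def fun_eq_iff split: if_splits\<close>)

lemma symmetric_parabolic_type_D:
  assumes "n \<ge> 2"
  shows "symmetric_parabolic (even_signed_sym_group n) (genD n) n n (signed_support n) signed_ext"
\<comment> \<open>The last generator also reverses \<open>(- 1, 1)\<close> and
  \<open>(- 2, 2)\<close>, but these are antipodal and not counted.\<close>
proof (rule symmetric_parabolic_signed[where E = "{(- 2, 1), (- 1, 2)}"])
  have "{i \<in> {1..int n}. signed_swap 1 (- 2) i < 0} = {1, 2}"
    using assms by (auto simp: signed_swap_def transpose_def split: if_splits)
  then show "genD n n \<in> carrier (even_signed_sym_group n)"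
    using assms signed_swap_permutes[of 1 n "- 2"] signed_swap_minus[of 1 "- 2"]
    by (auto simp: even_signed_sym_group_carrier signed_sym_group_carrier genD_def signed_support_def)
  show "genD n n \<circ> genD n n = id" "genD n n (- x) = - genD n n x" for x
    using signed_swap_minus[of 1 "- 2"] signed_swap_signed_swap[of 1 "- 2"] by (auto simp: genD_def)
  show "(u, v) \<in> {(- 2, 1), (- 1, 2)}"
    if "u \<noteq> 0" "v \<noteq> 0" "u < v" "v \<noteq> - u" "genD n n v < genD n n u" for u v
    using that by (auto simp: genD_def signed_swap_def transpose_def split: if_splits)
  show "signed_ext \<sigma> \<in> carrier (even_signed_sym_group n)" if "\<sigma> permutes {1..n}" for \<sigma>
  proof -
    have *: "{i \<in> {1..int n}. signed_ext \<sigma> i < 0} = {}"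
      by (auto simp: signed_ext_def)
    show ?thesis unfolding even_signed_sym_group_carrier signed_sym_group_carrier *
      using signed_ext_permutes[OF that] by (simp add: signed_ext_minus)
  qed
qed (use assms in \<open>auto simp: even_signed_sym_group_carrier signed_sym_group_carrier genD_def
      even_signed_sym_group_mult even_signed_sym_group_one\<close>)

theorem theorem6p4:
  shows "\<exists>c::real. c > 0 \<and>
    (\<forall>n::nat. n \<ge> 2 \<longrightarrow>
       real (card {w. proper_element (sym_group n) genA (n - 1) w}) \<ge> (c * real n) ^ n) \<and>
    (\<forall>n::nat. n \<ge> 4 \<longrightarrow>
       real (card {w. proper_element (even_signed_sym_group n) (genD n) n w}) \<ge> (c * real n) ^ n) \<and>
    (\<forall>n::nat. n \<ge> 2 \<longrightarrow>
       real (card {w. proper_element (signed_sym_group n) (genB n) n w}) \<ge> (c * real n) ^ n)"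
  using symmetric_parabolic.card_proper_elements_ge[OF symmetric_parabolic_type_A]
    symmetric_parabolic.card_proper_elements_ge[OF symmetric_parabolic_type_B]
    symmetric_parabolic.card_proper_elements_ge[OF symmetric_parabolic_type_D]
  by (intro exI[of _ "1 / 48"] conjI allI impI) simp_all

end
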